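(* Let $G$ be a strongly regular graph. The line graph of $G$ is distance magic if and only if $G$ is a cycle of order $4$.
   Context: Graphs are finite and simple. A distance-regular graph is a regular connected graph with degree $r$ and diameter $d$, for which there are positive integers $b_0=r,b_1,\ldots,b_{d-1},c_1=1,c_2,\ldots,c_d$ such that for any two vertices $u,v$ at distance $i$, there are precisely $c_i$ neighbours of $u$ at distance $i-1$ from $v$ ($1\le i\le d$) and precisely $b_i$ neighbours of $u$ at distance $i+1$ from $v$ ($0\le i\le d-1$). A strongly regular graph is a distance-regular graph of diameter at most $2$. The line graph of $G$ has the edges of $G$ as its vertices, two being adjacent when the edges share an endpoint. A graph $H$ on $n$ vertices is distance magic if there exist a bijection $f:V(H)\to\{1,2,\ldots,n\}$ and a constant $k$ such that $\sum_{y\in N(x)}f(y)=k$ for every vertex $x$, where $N(x)$ is the set of vertices adjacent to $x$.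
   Formalization: G is assumed not to be the complete graph on 2 or 4 vertices: both are strongly regular as defined and have distance magic line graphs, but are not 4-cycles. The one-vertex graph is not counted as strongly regular, since the degree must be positive. *)

theory Defs
  imports Main
begin

record 'a sgraph =
  verts :: "'a set"
  edges :: "'a set set"

definition simple_graph :: "'a sgraph \<Rightarrow> bool" where
  "simple_graph G \<longleftrightarrow>
     finite (verts G) \<and> verts G \<noteq> {} \<and> (\<forall>e\<in>edges G. e \<subseteq> verts G \<and> card e = 2)"

definition nbrs :: "'a sgraph \<Rightarrow> 'a \<Rightarrow> 'a set" where
  "nbrs G v = {u. {u, v} \<in> edges G}"

definition adj_rel :: "'a sgraph \<Rightarrow> 'a rel" where
  "adj_rel G = {(u, v). {u, v} \<in> edges G}"

definition connected_graph :: "'a sgraph \<Rightarrow> bool" where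
  "connected_graph G \<longleftrightarrow> (\<forall>u\<in>verts G. \<forall>v\<in>verts G. (u, v) \<in> (adj_rel G)\<^sup>*)"

text \<open>Length of a shortest walk; meaningful only when there is a walk from \<open>u\<close> to \<open>v\<close>.\<close>
definition gdist :: "'a sgraph \<Rightarrow> 'a \<Rightarrow> 'a \<Rightarrow> nat" where
  "gdist G u v = (LEAST n. (u, v) \<in> adj_rel G ^^ n)"

definition diameter :: "'a sgraph \<Rightarrow> nat" where
  "diameter G = Max {gdist G u v |u v. u \<in> verts G \<and> v \<in> verts G}"

definition regular_graph :: "'a sgraph \<Rightarrow> nat \<Rightarrow> bool" where
  "regular_graph G r \<longleftrightarrow> (\<forall>v\<in>verts G. card (nbrs G v) = r)"

text \<open>Only \<open>b 0, \<dots>, b (d - 1)\<close> and \<open>c 1, \<dots>, c d\<close> are significant. The degree \<open>r = b 0\<close> is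
  required to be positive, so the one-vertex graph is not distance-regular.\<close>
definition distance_regular :: "'a sgraph \<Rightarrow> bool" where
  "distance_regular G \<longleftrightarrow>
     simple_graph G \<and> connected_graph G \<and>
     (\<exists>r b c. let d = diameter G in
        regular_graph G r \<and> r > 0 \<and> b 0 = r \<and> c 1 = (1::nat) \<and>
        (\<forall>i<d. b i > (0::nat)) \<and> (\<forall>i\<in>{1..d}. c i > 0) \<and>
        (\<forall>u\<in>verts G. \<forall>v\<in>verts G. \<forall>i\<in>{1..d}. gdist G u v = i \<longrightarrow>
           card {w \<in> nbrs G u. gdist G w v = i - 1} = c i) \<and>
        (\<forall>u\<in>verts G. \<forall>v\<in>verts G. \<forall>i<d. gdist G u v = i \<longrightarrow>
           card {w \<in> nbrs G u. gdist G w v = i + 1} = b i))"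

text \<open>Since the diameter may be 1, complete graphs on at least two vertices are included.\<close>
definition strongly_regular :: "'a sgraph \<Rightarrow> bool" where
  "strongly_regular G \<longleftrightarrow> distance_regular G \<and> diameter G \<le> 2"

definition line_graph :: "'a sgraph \<Rightarrow> 'a set sgraph" where
  "line_graph G =
     \<lparr>verts = edges G,
      edges = {{e, f} |e f. e \<in> edges G \<and> f \<in> edges G \<and> e \<noteq> f \<and> e \<inter> f \<noteq> {}}\<rparr>"

definition distance_magic :: "'a sgraph \<Rightarrow> bool" where
  "distance_magic H \<longleftrightarrow>
     (\<exists>(f :: 'a \<Rightarrow> nat) k. bij_betw f (verts H) {1..card (verts H)} \<and>
        (\<forall>x\<in>verts H. (\<Sum>y\<in>nbrs H x. f y) = k))"

definition cycle_graph :: "nat \<Rightarrow> 'a sgraph \<Rightarrow> bool" where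
  "cycle_graph n G \<longleftrightarrow> n \<ge> 3 \<and>
     (\<exists>g. bij_betw g {..<n} (verts G) \<and> edges G = {{g i, g (Suc i mod n)} |i. i < n})"

text \<open>The complete graphs of orders 2 and 4 are strongly regular in the above sense, are not
  4-cycles, and have distance magic line graphs: a single vertex with magic constant 0, and the
  octahedron, in which labels of opposite vertices sum to 7 and the magic constant is 14.\<close>
definition complete_graph :: "nat \<Rightarrow> 'a sgraph \<Rightarrow> bool" where
  "complete_graph n G \<longleftrightarrow>
     finite (verts G) \<and> card (verts G) = n \<and> edges G = {e. e \<subseteq> verts G \<and> card e = 2}"

end

theory Submission
  imports Defs
begin

text \<open>A magic labelling of the line graph of an \<open>r\<close>-regular graph is, up to affine changes, of the
  form \<open>uv \<mapsto> h u + h v\<close>, where \<open>h\<close> is an eigenvector of \<open>G\<close> for the eigenvalue \<open>2 - r\<close>. For complete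
  graphs this forces \<open>r = 3\<close>. In diameter 2 the quadratic equation for the eigenvalues, with
  \<open>0 < mu \<le> r\<close>, leaves the 4-cycle and three families. If \<open>mu = r \<ge> 4\<close> (the octahedron), vertices at
  distance 2 are twins, so \<open>h\<close> agrees on them and two edges get the same label. For the parameters
  \<open>(9, 4, 1, 2)\<close> and \<open>(16, 5, 0, 2)\<close>, \<open>h\<close> sums to zero over every triangle, respectively every 4-cycle;
  so two edges completing the triangles at a vertex, respectively the 4-cycles at an edge, get the
  same label.\<close>

locale regular_nbrs =
  fixes V :: "'a set" and N :: "'a \<Rightarrow> 'a set" and r :: nat
  assumes finite_V: "finite V"
    and nbrs_subset: "\<And>x. x \<in> V \<Longrightarrow> N x \<subseteq> V"
    and nbrs_sym: "\<And>x y. y \<in> N x \<longleftrightarrow> x \<in> N y"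
    and nbrs_irrefl: "\<And>x. x \<notin> N x"
    and card_nbrs: "\<And>x. x \<in> V \<Longrightarrow> card (N x) = r"
begin

lemma finite_nbrs: "x \<in> V \<Longrightarrow> finite (N x)"
  using finite_V nbrs_subset finite_subset by blast

text \<open>Double counting: by symmetry, \<open>y\<close> occurs once for each of its neighbours in
  \<open>C\<close>.\<close>

lemma sum_sum_nbrs:
  fixes g :: "'a \<Rightarrow> int"
  assumes "C \<subseteq> V"
  shows "(\<Sum>x\<in>C. \<Sum>y\<in>N x. g y) = (\<Sum>y\<in>V. int (card (N y \<inter> C)) * g y)"
proof -
  have finC: "finite C" using assms finite_V finite_subset by blast
  have "(\<Sum>x\<in>C. \<Sum>y\<in>N x. g y) = (\<Sum>x\<in>C. \<Sum>y\<in>V. if y \<in> N x then g y else 0)"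
  proof (rule sum.cong[OF refl])
    fix x assume "x \<in> C"
    then have "V \<inter> N x = N x" using assms nbrs_subset by blast
    then show "(\<Sum>y\<in>N x. g y) = (\<Sum>y\<in>V. if y \<in> N x then g y else 0)"
      using sum.inter_restrict[OF finite_V, of g "N x"] by simp
  qed
  also have "\<dots> = (\<Sum>y\<in>V. \<Sum>x\<in>C. if y \<in> N x then g y else 0)" by (rule sum.swap)
  also have "\<dots> = (\<Sum>y\<in>V. int (card (N y \<inter> C)) * g y)"
  proof (rule sum.cong[OF refl])
    fix y
    have "(\<Sum>x\<in>C. if y \<in> N x then g y else 0) = (\<Sum>x\<in>C. if x \<in> N y then g y else 0)"
      using nbrs_sym by simp
    also have "\<dots> = (\<Sum>x\<in>C \<inter> N y. g y)"
      using sum.inter_restrict[OF finC, of "\<lambda>_. g y" "N y"] by simp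
    finally show "(\<Sum>x\<in>C. if y \<in> N x then g y else 0) = int (card (N y \<inter> C)) * g y"
      by (simp add: Int_commute)
  qed
  finally show ?thesis .
qed

end

locale srg = regular_nbrs +
  fixes lam mu :: nat
  assumes card_adj: "\<And>x y. \<lbrakk>x \<in> V; y \<in> N x\<rbrakk> \<Longrightarrow> card (N x \<inter> N y) = lam"
    and card_nonadj: "\<And>x y. \<lbrakk>x \<in> V; y \<in> V; x \<noteq> y; y \<notin> N x\<rbrakk> \<Longrightarrow> card (N x \<inter> N y) = mu"
begin

text \<open>This is \<open>A^2 = r I + lam A + mu (J - I - A)\<close> for the adjacency matrix
  \<open>A\<close>, applied to \<open>g\<close> and read off at \<open>x\<close>; the three terms
  come from \<open>x\<close> itself, its neighbours and the remaining vertices.\<close>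

lemma sum_two_step:
  fixes g :: "'a \<Rightarrow> int"
  assumes x: "x \<in> V"
  shows "(\<Sum>y\<in>N x. \<Sum>z\<in>N y. g z) =
    int r * g x + int lam * sum g (N x) + int mu * (sum g V - g x - sum g (N x))"
proof -
  let ?R = "V - insert x (N x)"
  have sub: "insert x (N x) \<subseteq> V" using x nbrs_subset by blast
  have split: "sum k V = sum k ?R + k x + sum k (N x)" for k :: "'a \<Rightarrow> int"
    using sum.subset_diff[OF sub finite_V, of k] finite_nbrs[OF x] nbrs_irrefl[of x] by simp
  have "(\<Sum>y\<in>N x. \<Sum>z\<in>N y. g z) = (\<Sum>z\<in>V. int (card (N z \<inter> N x)) * g z)"
    using sum_sum_nbrs[OF nbrs_subset[OF x]] .
  also have "\<dots> = (\<Sum>z\<in>?R. int (card (N z \<inter> N x)) * g z) + int (card (N x \<inter> N x)) * g x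
      + (\<Sum>z\<in>N x. int (card (N z \<inter> N x)) * g z)"
    by (rule split)
  also have "(\<Sum>z\<in>?R. int (card (N z \<inter> N x)) * g z) = (\<Sum>z\<in>?R. int mu * g z)"
    by (rule sum.cong[OF refl]) (use x card_nonadj[OF x] in \<open>auto simp: Int_commute\<close>)
  also have "(\<Sum>z\<in>N x. int (card (N z \<inter> N x)) * g z) = (\<Sum>z\<in>N x. int lam * g z)"
    by (rule sum.cong[OF refl]) (use card_adj[OF x] in \<open>auto simp: Int_commute\<close>)
  finally show ?thesis
    using split[of g] x by (simp add: card_nbrs sum_distrib_left[symmetric])
qed

text \<open>The two-step identity for the constant function 1 counts walks of length 2 from
  \<open>x\<close>; for \<open>mu > 0\<close> it determines the order of the graph.\<close>

lemma card_vertices: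
  assumes "x \<in> V"
  shows "int r * int r = int r + int lam * int r + int mu * (int (card V) - 1 - int r)"
proof -
  have "(\<Sum>y\<in>N x. \<Sum>z\<in>N y. (1::int)) = (\<Sum>y\<in>N x. int r)"
    by (rule sum.cong[OF refl]) (use assms nbrs_subset card_nbrs in auto)
  then show ?thesis using sum_two_step[OF assms, of "\<lambda>_. 1"] assms by (simp add: card_nbrs)
qed

end

section \<open>Eigenvectors for \<open>2 - r\<close> that separate edges\<close>

text \<open>All that is kept of a magic labelling: \<open>h x + h y\<close> stands for the label of
  the edge \<open>xy\<close> up to an affine change, and \<open>edge_inj\<close> says that labels
  are distinct.\<close>

locale magic_weight = regular_nbrs +
  fixes h :: "'a \<Rightarrow> int"
  assumes degree_ge_2: "r \<ge> 2"
    and nonempty: "V \<noteq> {}"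
    and eigen: "\<And>x. x \<in> V \<Longrightarrow> (\<Sum>y\<in>N x. h y) = (2 - int r) * h x"
    and edge_inj: "\<And>x y u v. \<lbrakk>x \<in> V; y \<in> N x; u \<in> V; v \<in> N u; h x + h y = h u + h v\<rbrakk>
      \<Longrightarrow> {x, y} = {u, v}"
begin

text \<open>Otherwise two edges at a vertex, present since \<open>r \<ge> 2\<close>, would both have
  sum 0.\<close>

lemma nonzero: "\<exists>x\<in>V. h x \<noteq> 0"
proof (rule ccontr)
  assume zero: "\<not> ?thesis"
  obtain x where x: "x \<in> V" using nonempty by blast
  have "2 \<le> card (N x)" using degree_ge_2 card_nbrs[OF x] by simp
  then obtain T where "T \<subseteq> N x" "card T = 2" by (meson obtain_subset_with_card_n)
  then obtain y z where yz: "y \<in> N x" "z \<in> N x" "y \<noteq> z" by (auto simp: card_2_iff)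
  then have "h y = 0" "h z = 0" "h x = 0" using zero x nbrs_subset by auto
  then have "{x, y} = {x, z}" using edge_inj[of x y x z] x yz by simp
  then show False using yz by (auto simp: doubleton_eq_iff)
qed

text \<open>An eigenvector for an eigenvalue other than \<open>r\<close> is orthogonal to the
  all-one vector.\<close>

lemma sum_zero: "sum h V = 0"
proof -
  have "(\<Sum>x\<in>V. \<Sum>y\<in>N x. h y) = (\<Sum>y\<in>V. int (card (N y \<inter> V)) * h y)"
    by (rule sum_sum_nbrs) simp
  also have "\<dots> = (\<Sum>y\<in>V. int r * h y)"
    by (rule sum.cong[OF refl]) (use nbrs_subset card_nbrs in \<open>auto simp: Int_absorb2\<close>)
  finally have "(\<Sum>x\<in>V. (2 - int r) * h x) = (\<Sum>y\<in>V. int r * h y)" using eigen by simp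
  then have "(2 - int r) * sum h V = int r * sum h V" by (simp add: sum_distrib_left)
  then show ?thesis using degree_ge_2 by simp
qed

lemma common_nbr_inj:
  assumes "x \<in> V" "y \<in> N x" "z \<in> N x" "h y = h z"
  shows "y = z"
  using edge_inj[of x y x z] assms by (auto simp: doubleton_eq_iff)

text \<open>Since \<open>h\<close> sums to zero, its sum over \<open>V - {x}\<close> is
  \<open>- h x\<close>; so the eigenvalue \<open>2 - r\<close> is -1.\<close>

lemma complete_card:
  assumes "\<And>x. x \<in> V \<Longrightarrow> N x = V - {x}"
  shows "card V = 4"
proof -
  obtain x where x: "x \<in> V" "h x \<noteq> 0" using nonzero by blast
  have "sum h (N x) = - h x" using assms[OF x(1)] sum_zero sum_diff1[OF finite_V, of h x] x by simp
  then have "(2 - int r) * h x = (-1) * h x" using eigen[OF x(1)] by simp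
  then have "2 - int r = -1" using x(2) by (metis mult_cancel_right)
  then have "r = 3" by simp
  then have "card (V - {x}) = 3" using assms[OF x(1)] card_nbrs[OF x(1)] by simp
  then show ?thesis using x finite_V by (simp add: card_Diff_singleton)
qed

text \<open>The counting hypothesis forces every vertex outside \<open>C\<close> to have exactly one neighbour in
  \<open>C\<close>, so the partition of \<open>V\<close> into \<open>C\<close> and its complement is equitable, with an eigenvalue of
  the quotient different from \<open>2 - r\<close>.\<close>

lemma sum_perfect_set:
  assumes C: "C \<subseteq> V"
    and inside: "\<And>x. x \<in> C \<Longrightarrow> card (N x \<inter> C) = 2"
    and outside: "\<And>y. y \<in> V - C \<Longrightarrow> card (N y \<inter> C) \<le> 1"
    and count: "int (card V) = int (card C) * (int r - 1)"
  shows "sum h C = 0"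
proof -
  have finC: "finite C" using C finite_V finite_subset by blast
  have fin: "finite (V - C)" using finite_V by simp
  have base: "(\<Sum>x\<in>C. \<Sum>y\<in>N x. g y) =
      2 * sum g C + (\<Sum>y\<in>V - C. int (card (N y \<inter> C)) * g y)" for g
    using sum_sum_nbrs[OF C, of g] sum.subset_diff[OF C finite_V, of "\<lambda>y. int (card (N y \<inter> C)) * g y"]
      inside by (simp add: sum_distrib_left)
  have "(\<Sum>x\<in>C. \<Sum>y\<in>N x. (1::int)) = (\<Sum>x\<in>C. int r)"
    by (rule sum.cong[OF refl]) (use C card_nbrs in auto)
  then have "int (card C) * int r = 2 * int (card C) + (\<Sum>y\<in>V - C. int (card (N y \<inter> C)))"
    using base[of "\<lambda>_. 1"] by simp
  \<comment> \<open>By \<open>count\<close>, the \<open>card C * (r - 2)\<close> edges leaving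
    \<open>C\<close> are as many as the vertices outside, so the bound 1 in \<open>outside\<close>
    is attained everywhere.\<close>
  then have "(\<Sum>y\<in>V - C. int (card (N y \<inter> C))) = int (card (V - C))"
    using count card_Diff_subset[OF finC C] card_mono[OF finite_V C]
    by (simp add: algebra_simps of_nat_diff)
  then have "(\<Sum>y\<in>V - C. 1 - int (card (N y \<inter> C))) = 0"
    by (simp add: sum_subtractf)
  then have "\<forall>y\<in>V - C. 1 - int (card (N y \<inter> C)) = 0"
    by (subst (asm) sum_nonneg_eq_0_iff[OF fin]) (use outside in force)+
  then have "(\<Sum>y\<in>V - C. int (card (N y \<inter> C)) * h y) = sum h (V - C)" by simp
  also have "\<dots> = - sum h C" using sum.subset_diff[OF C finite_V, of h] sum_zero by simp
  finally have "(\<Sum>x\<in>C. (2 - int r) * h x) = sum h C"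
    using base[of h] eigen C by (simp add: subset_iff)
  then have "(2 - int r) * sum h C = sum h C" by (simp add: sum_distrib_left)
  then have "(1 - int r) * sum h C = 0" by (simp add: algebra_simps)
  then show ?thesis using degree_ge_2 by simp
qed

end

section \<open>The quadratic equation for the parameters\<close>

text \<open>For \<open>r \<ge> 4\<close> and \<open>s = r - 3\<close> the equation reads
  \<open>(s + 3 - mu) * s = (2 - lam) * (s + 1)\<close>. The left side is nonnegative because
  \<open>mu \<le> r\<close>, so \<open>lam \<le> 2\<close>, and each value of \<open>lam\<close> is
  settled by divisibility.\<close>

lemma srg_feasible_parameters:
  fixes r lam mu :: nat
  assumes "r \<ge> 2" "mu > 0" "mu \<le> r" "lam + 2 \<le> r"
    and eq: "(2 - int r) * (2 - int r) = int r + int lam * (2 - int r) + int mu * (int r - 3)"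
  shows "r = 2 \<and> lam = 0 \<and> mu = 2 \<or> lam = 2 \<and> mu = r \<and> r \<ge> 4 \<or>
    r = 4 \<and> lam = 1 \<and> mu = 2 \<or> r = 5 \<and> lam = 0 \<and> mu = 2"
proof -
  consider "r = 2" | "r = 3" | "r \<ge> 4" using assms(1) by linarith
  then show ?thesis
  proof cases
    case 1 then show ?thesis using assms by simp
  next
    \<comment> \<open>Here the equation forces \<open>lam = 2\<close>, against
      \<open>lam + 2 \<le> r\<close>.\<close>
    case 2 then show ?thesis using assms by simp
  next
    case 3
    define s where "s = int r - 3"
    have s: "s \<ge> 1" "int r = s + 3" using 3 by (auto simp: s_def)
    have eq': "(s + 1) * (s + 1) = s + 3 - int lam * (s + 1) + int mu * s"
      using eq s(2) by (simp add: algebra_simps)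
    have "(s + 3 - int mu) * s = (2 - int lam) * (s + 1)"
      using eq' by (simp add: algebra_simps)
    moreover have "(s + 3 - int mu) * s \<ge> 0" using s assms(3) by simp
    ultimately have "(2 - int lam) * (s + 1) \<ge> 0" by simp
    then have "lam \<le> 2" using s by (simp add: zero_le_mult_iff)
    then consider "lam = 0" | "lam = 1" | "lam = 2" by linarith
    then show ?thesis
    proof cases
      case 1
      then have e: "(s + 1 - int mu) * s = 2" using eq' by (simp add: algebra_simps)
      then have "s dvd 2" by (metis dvd_triv_right)
      then have "s = 1 \<or> s = 2" using s(1) zdvd_imp_le[of s 2] by linarith
      \<comment> \<open>\<open>s = 1\<close> would give \<open>mu = 0\<close>; \<open>s = 2\<close>
        gives \<open>r = 5\<close> and \<open>mu = 2\<close>.\<close>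
      then show ?thesis using e s 1 assms(2) by auto
    next
      case 2
      then have e: "(s + 2 - int mu) * s = 1" using eq' by (simp add: algebra_simps)
      then have "s = 1" using s(1) by (metis dvd_triv_right zdvd_imp_le zero_less_one order_antisym)
      then show ?thesis using e s 2 by auto
    next
      case c: 3
      then have "(s + 3 - int mu) * s = 0" using eq' by (simp add: algebra_simps)
      then show ?thesis using s c 3 by auto
    qed
  qed
qed

section \<open>Excluding the parameter families other than the 4-cycle\<close>

locale magic_srg = srg + magic_weight
begin

text \<open>Both sides are the factor by which two steps scale \<open>h\<close>, once by the
  eigenvalue and once by the two-step identity, where \<open>sum_zero\<close> removes the global
  term.\<close>

lemma quadratic:
  "(2 - int r) * (2 - int r) = int r + int lam * (2 - int r) + int mu * (int r - 3)"
proof -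
  obtain x where x: "x \<in> V" "h x \<noteq> 0" using nonzero by blast
  have "(\<Sum>y\<in>N x. \<Sum>z\<in>N y. h z) = (\<Sum>y\<in>N x. (2 - int r) * h y)"
    by (rule sum.cong[OF refl]) (use eigen nbrs_subset[OF x(1)] in auto)
  also have "\<dots> = (2 - int r) * ((2 - int r) * h x)"
    using eigen[OF x(1)] by (simp add: sum_distrib_left[symmetric])
  finally have "((2 - int r) * (2 - int r)) * h x =
      (int r + int lam * (2 - int r) + int mu * (int r - 3)) * h x"
    using sum_two_step[OF x(1), of h] sum_zero eigen[OF x(1)] by (simp add: algebra_simps)
  then show ?thesis using x(2) by (metis mult_cancel_right)
qed

text \<open>Here \<open>N x = N y\<close>, so the eigenvalue equation with
  \<open>2 - r \<noteq> 0\<close> gives \<open>h x = h y\<close>, and the edges from a common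
  neighbour to \<open>x\<close> and \<open>y\<close> collide.\<close>

lemma no_twins:
  assumes x: "x \<in> V" "y \<in> V" "x \<noteq> y" "y \<notin> N x" and "mu = r" "r \<ge> 4"
  shows False
proof -
  have c: "card (N x \<inter> N y) = r" using card_nonadj[OF x] assms by simp
  have "N x \<inter> N y = N x" "N x \<inter> N y = N y"
    by (rule card_subset_eq; use c x finite_nbrs card_nbrs in simp)+
  then have "N x = N y" by simp
  then have "(2 - int r) * h x = (2 - int r) * h y" using eigen x by metis
  then have "h x = h y" using assms by simp
  moreover have "N x \<inter> N y \<noteq> {}" using c \<open>r \<ge> 4\<close> by auto
  then obtain z where "z \<in> N x \<inter> N y" by blast
  then have "z \<in> V" "x \<in> N z" "y \<in> N z" using nbrs_sym nbrs_subset x by blast+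
  ultimately show False using common_nbr_inj x(3) by blast
qed

text \<open>A triangle is a set as in \<open>sum_perfect_set\<close>: the graph has 9 = 3 * 3
  vertices, and an outside vertex adjacent to two corners would give their edge a second common
  neighbour.\<close>

lemma triangle_sum_zero:
  assumes p: "r = 4" "lam = 1" "mu = 2"
    and x: "x \<in> V" and a: "a \<in> N x" and b: "b \<in> N x \<inter> N a"
  shows "h x + h a + h b = 0"
proof -
  have aV: "a \<in> V" "b \<in> V" using x a b nbrs_subset by auto
  have ne: "x \<noteq> a" "x \<noteq> b" "a \<noteq> b" using a b nbrs_irrefl by auto
  have adj: "a \<in> N x" "b \<in> N x" "b \<in> N a" "x \<in> N a" "x \<in> N b" "a \<in> N b"
    using a b nbrs_sym by auto
  have uniq: "w = z" if "u \<in> V" "v \<in> N u" "w \<in> N u \<inter> N v" "z \<in> N u \<inter> N v" for u v w z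
    using card_adj[OF that(1,2)] that(3,4) p(2) by (metis card_1_singleton_iff One_nat_def singletonD)
  let ?C = "{x, a, b}"
  have "sum h ?C = 0"
  proof (rule sum_perfect_set)
    show "?C \<subseteq> V" using x aV by simp
    show "card (N z \<inter> ?C) = 2" if "z \<in> ?C" for z
    proof -
      have "N z \<inter> ?C = ?C - {z}" using that adj nbrs_irrefl by auto
      then show ?thesis using that ne by auto
    qed
    show "card (N y \<inter> ?C) \<le> 1" if y: "y \<in> V - ?C" for y
    proof (rule card_le_Suc0_iff_eq[THEN iffD2, unfolded One_nat_def[symmetric]])
      have "u = v" if uv: "u \<in> N y" "v \<in> N y" "u \<in> ?C" "v \<in> ?C" for u v
      proof (rule ccontr)
        assume "u \<noteq> v"
        then obtain z where z: "z \<in> ?C" "z \<in> N u \<inter> N v" "v \<in> N u"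
          using uv adj by blast
        have "u \<in> V" using uv x aV by auto
        moreover have "y \<in> N u \<inter> N v" using uv nbrs_sym by auto
        ultimately show False using uniq[of u v z y] z y by auto
      qed
      then show "\<forall>u\<in>N y \<inter> ?C. \<forall>v\<in>N y \<inter> ?C. u = v" by blast
    qed simp
    show "int (card V) = int (card ?C) * (int r - 1)"
      using card_vertices[OF x] p ne by simp
  qed
  then show ?thesis using ne by simp
qed

text \<open>Two triangles through \<open>x\<close> share no other vertex, and their edges opposite
  \<open>x\<close> both have sum \<open>- h x\<close>.\<close>

lemma parameters_not_4_1_2:
  assumes p: "r = 4" "lam = 1" "mu = 2"
  shows False
proof -
  obtain x where x: "x \<in> V" using nonempty by blast
  have "N x \<noteq> {}" using card_nbrs[OF x] p by auto
  then obtain a where a: "a \<in> N x" by blast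
  have "card (N x \<inter> N a) = 1" using card_adj[OF x a] p by simp
  then obtain b where b: "N x \<inter> N a = {b}" by (auto simp: card_1_singleton_iff)
  have "\<not> N x \<subseteq> {a, b}"
  proof
    assume "N x \<subseteq> {a, b}"
    then have "card (N x) \<le> card {a, b}" by (intro card_mono) auto
    also have "\<dots> \<le> 2" by (simp add: card_insert_if)
    finally show False using card_nbrs[OF x] p by simp
  qed
  then obtain c where c: "c \<in> N x" "c \<noteq> a" "c \<noteq> b" by blast
  have "card (N x \<inter> N c) = 1" using card_adj[OF x c(1)] p by simp
  then obtain d where d: "N x \<inter> N c = {d}" by (auto simp: card_1_singleton_iff)
  have "h x + h a + h b = 0" "h x + h c + h d = 0"
    using triangle_sum_zero[OF p x a, of b] triangle_sum_zero[OF p x c(1), of d] b d by auto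
  then have "h a + h b = h c + h d" by linarith
  moreover have "a \<in> V" "c \<in> V" "b \<in> N a" "d \<in> N c"
    using x a c b d nbrs_subset by blast+
  ultimately have "{a, b} = {c, d}" using edge_inj by blast
  then show False using c by (auto simp: doubleton_eq_iff)
qed

text \<open>A 4-cycle is a set as in \<open>sum_perfect_set\<close>: the graph has 16 = 4 * 4
  vertices. An outside vertex cannot see two adjacent corners, as \<open>lam = 0\<close>, nor two
  opposite ones, whose \<open>mu = 2\<close> common neighbours are the other two corners.\<close>

lemma quadrangle_sum_zero:
  assumes p: "r = 5" "lam = 0" "mu = 2"
    and u: "u \<in> V" and v: "v \<in> N u" and y: "y \<in> N u" "y \<noteq> v"
    and x: "x \<in> N v \<inter> N y" "x \<noteq> u"
  shows "h u + h v + h x + h y = 0"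
proof -
  have V: "v \<in> V" "y \<in> V" "x \<in> V" using u v y x nbrs_subset by blast+
  have no_tri: "w \<notin> N s \<inter> N t" if "s \<in> V" "t \<in> N s" for s t w
    using card_adj[OF that] finite_nbrs[OF that(1)] p by auto
  have adj: "v \<in> N u" "y \<in> N u" "u \<in> N v" "u \<in> N y" "x \<in> N v" "x \<in> N y" "v \<in> N x" "y \<in> N x"
    using v x y nbrs_sym by blast+
  have nadj: "y \<notin> N v" "v \<notin> N y" "x \<notin> N u" "u \<notin> N x"
    using no_tri u V adj nbrs_sym by blast+
  have ne: "u \<noteq> v" "u \<noteq> y" "x \<noteq> v" "x \<noteq> y" using adj nbrs_irrefl by auto
  have vy: "N v \<inter> N y = {u, x}"
    using card_subset_eq[of "N v \<inter> N y" "{u, x}"] card_nonadj[of v y] V p adj nadj y(2) x(2)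
      finite_nbrs by simp
  have ux: "N u \<inter> N x = {v, y}"
    using card_subset_eq[of "N u \<inter> N x" "{v, y}"] card_nonadj[of u x] u V p adj nadj y(2) x(2)
      finite_nbrs by simp
  let ?C = "{u, v, x, y}"
  have "sum h ?C = 0"
  proof (rule sum_perfect_set)
    show "?C \<subseteq> V" using u V by simp
    show "card (N z \<inter> ?C) = 2" if "z \<in> ?C" for z
    proof -
      have "N z \<inter> ?C = (if z = u \<or> z = x then {v, y} else {u, x})"
        using that adj nadj nbrs_irrefl by auto
      then show ?thesis using y x by auto
    qed
    show "card (N z \<inter> ?C) \<le> 1" if z: "z \<in> V - ?C" for z
    proof (rule card_le_Suc0_iff_eq[THEN iffD2, unfolded One_nat_def[symmetric]])
      have "s = t" if st: "s \<in> N z" "t \<in> N z" "s \<in> ?C" "t \<in> ?C" for s t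
      proof (rule ccontr)
        assume "s \<noteq> t"
        have zst: "z \<in> N s \<inter> N t" using st nbrs_sym by auto
        have "s \<in> V" using st u V by auto
        then have "t \<notin> N s" using no_tri zst by blast
        then have "{s, t} = {u, x} \<or> {s, t} = {v, y}" using st adj \<open>s \<noteq> t\<close> by auto
        then have "N s \<inter> N t \<subseteq> ?C" using ux vy by (auto simp: doubleton_eq_iff)
        then show False using zst z by blast
      qed
      then show "\<forall>s\<in>N z \<inter> ?C. \<forall>t\<in>N z \<inter> ?C. s = t" by blast
    qed simp
    show "int (card V) = int (card ?C) * (int r - 1)"
      using card_vertices[OF u] p ne y x by simp
  qed
  then show ?thesis using ne y x by simp
qed

text \<open>Two 4-cycles through the edge \<open>uv\<close> have their edges opposite
  \<open>uv\<close> of equal sum \<open>- (h u + h v)\<close>.\<close>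

lemma parameters_not_5_0_2:
  assumes p: "r = 5" "lam = 0" "mu = 2"
  shows False
proof -
  obtain u where u: "u \<in> V" using nonempty by blast
  have "3 \<le> card (N u)" using card_nbrs[OF u] p by simp
  then obtain T where "T \<subseteq> N u" "card T = 3" by (meson obtain_subset_with_card_n)
  then obtain v y y' where T: "v \<in> N u" "y \<in> N u" "y' \<in> N u" "y \<noteq> v" "y' \<noteq> v" "y \<noteq> y'"
    by (auto simp: card_3_iff)
  have no_tri: "w \<notin> N s \<inter> N t" if "s \<in> V" "t \<in> N s" for s t w
    using card_adj[OF that] finite_nbrs[OF that(1)] p by auto
  have ex: "\<exists>x. x \<in> N v \<inter> N z \<and> x \<noteq> u" if z: "z \<in> N u" "z \<noteq> v" for z
  proof -
    have V: "v \<in> V" "z \<in> V" using u T z nbrs_subset by blast+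
    have "z \<notin> N v" using no_tri[of u v z] u T z by blast
    then have "card (N v \<inter> N z) = 2" using card_nonadj V z p by auto
    then obtain c d where "N v \<inter> N z = {c, d}" "c \<noteq> d" by (auto simp: card_2_iff)
    then show ?thesis by (cases "c = u") auto
  qed
  obtain x x' where x: "x \<in> N v \<inter> N y" "x \<noteq> u" and x': "x' \<in> N v \<inter> N y'" "x' \<noteq> u"
    using ex T by meson
  have "h u + h v + h x + h y = 0" "h u + h v + h x' + h y' = 0"
    using quadrangle_sum_zero[OF p u T(1) T(2) T(4) x]
      quadrangle_sum_zero[OF p u T(1) T(3) T(5) x'] by auto
  then have "h y + h x = h y' + h x'" by linarith
  moreover have "y \<in> V" "y' \<in> V" "x \<in> N y" "x' \<in> N y'"
    using u T x x' nbrs_subset by blast+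
  ultimately have "{y, x} = {y', x'}" using edge_inj by blast
  \<comment> \<open>As \<open>y \<noteq> y'\<close>, the equality forces \<open>y = x'\<close>,
    which closes a triangle \<open>u\<close>, \<open>v\<close>, \<open>y\<close>.\<close>
  then have "y \<in> N u \<inter> N v" using T x' by (auto simp: doubleton_eq_iff)
  then show False using no_tri u T by blast
qed

text \<open>The nonadjacent pair serves twice: it bounds \<open>mu\<close> by \<open>r\<close>, and
  it provides the twins when \<open>mu = r \<ge> 4\<close>.\<close>

lemma parameters_eq:
  assumes "x \<in> V" "y \<in> V" "x \<noteq> y" "y \<notin> N x" and "mu > 0" "lam + 2 \<le> r"
  shows "r = 2 \<and> lam = 0 \<and> mu = 2"
proof -
  have "mu = card (N x \<inter> N y)" using card_nonadj assms by simp
  also have "\<dots> \<le> card (N x)" using assms finite_nbrs by (intro card_mono) auto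
  finally have "mu \<le> r" using assms card_nbrs by simp
  then show ?thesis
    using srg_feasible_parameters[OF degree_ge_2 assms(5) _ assms(6) quadratic]
      no_twins[OF assms(1-4)] parameters_not_4_1_2 parameters_not_5_0_2 by blast
qed

end

section \<open>Distances, and the parameters of a strongly regular graph\<close>

lemma nbrs_simple_graph:
  assumes "simple_graph G" "u \<in> nbrs G v"
  shows "u \<in> verts G" "v \<in> verts G" "u \<noteq> v"
proof -
  have "{u, v} \<subseteq> verts G" "card {u, v} = 2"
    using assms unfolding simple_graph_def nbrs_def by blast+
  then show "u \<in> verts G" "v \<in> verts G" "u \<noteq> v" by auto
qed

lemma nbrs_commute: "u \<in> nbrs G v \<longleftrightarrow> v \<in> nbrs G u"
  by (simp add: nbrs_def insert_commute[of u v])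

lemma edgeE:
  assumes "simple_graph G" "e \<in> edges G"
  obtains u v where "e = {u, v}" "u \<in> verts G" "v \<in> nbrs G u" "u \<noteq> v"
proof -
  obtain u v where uv: "e = {u, v}" "u \<noteq> v"
    using assms unfolding simple_graph_def by (meson card_2_iff)
  then have "v \<in> nbrs G u" using assms by (simp add: nbrs_def insert_commute)
  then show ?thesis using that uv nbrs_simple_graph[OF assms(1)] by blast
qed

lemma edge_iff_nbr: "{u, v} \<in> edges G \<longleftrightarrow> v \<in> nbrs G u"
  by (simp add: nbrs_def insert_commute[of u v])

lemma gdist_walk:
  assumes "connected_graph G" "u \<in> verts G" "v \<in> verts G"
  shows "(u, v) \<in> adj_rel G ^^ gdist G u v"
proof -
  have "\<exists>n. (u, v) \<in> adj_rel G ^^ n"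
    using assms by (simp add: connected_graph_def rtrancl_power)
  then show ?thesis unfolding gdist_def by (rule LeastI_ex)
qed

lemma gdist_eq_0_iff:
  assumes "connected_graph G" "u \<in> verts G" "v \<in> verts G"
  shows "gdist G u v = 0 \<longleftrightarrow> u = v"
proof
  assume "gdist G u v = 0"
  then show "u = v" using gdist_walk[OF assms] by simp
next
  assume "u = v"
  then have "gdist G u v \<le> 0" unfolding gdist_def by (intro Least_le) simp
  then show "gdist G u v = 0" by simp
qed

lemma gdist_eq_1_iff:
  assumes "simple_graph G" "connected_graph G" "u \<in> verts G" "v \<in> verts G"
  shows "gdist G u v = 1 \<longleftrightarrow> u \<in> nbrs G v"
proof
  assume "gdist G u v = 1"
  then show "u \<in> nbrs G v"
    using gdist_walk[OF assms(2-4)] by (simp add: adj_rel_def nbrs_def)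
next
  assume u: "u \<in> nbrs G v"
  then have "gdist G u v \<le> 1"
    unfolding gdist_def by (intro Least_le) (simp add: adj_rel_def nbrs_def)
  moreover have "gdist G u v \<noteq> 0"
    using gdist_eq_0_iff[OF assms(2-4)] nbrs_simple_graph[OF assms(1) u] by simp
  ultimately show "gdist G u v = 1" by simp
qed

lemma finite_gdist_set:
  "finite (verts G) \<Longrightarrow> finite {gdist G u v |u v. u \<in> verts G \<and> v \<in> verts G}"
  by (rule finite_image_set2) simp_all

lemma gdist_le_diameter:
  assumes "finite (verts G)" "u \<in> verts G" "v \<in> verts G"
  shows "gdist G u v \<le> diameter G"
  unfolding diameter_def by (rule Max_ge[OF finite_gdist_set]) (use assms in blast)+

lemma diameter_attained:
  assumes "finite (verts G)" "verts G \<noteq> {}"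
  obtains u v where "u \<in> verts G" "v \<in> verts G" "gdist G u v = diameter G"
proof -
  have "diameter G \<in> {gdist G u v |u v. u \<in> verts G \<and> v \<in> verts G}"
    unfolding diameter_def using assms by (intro Max_in finite_gdist_set) auto
  then obtain u v where "diameter G = gdist G u v" "u \<in> verts G" "v \<in> verts G" by auto
  then show ?thesis by (intro that) simp_all
qed

text \<open>Diameter 0 is impossible because \<open>r > 0\<close>. Diameter 1 gives the complete
  graphs; diameter 2 gives \<open>mu = c 2\<close> and \<open>lam = r - 1 - b 1\<close>, with
  \<open>lam + 2 \<le> r\<close> because \<open>b 1 > 0\<close>.\<close>

lemma strongly_regular_cases:
  assumes "strongly_regular G"
  obtains
    (complete) r where "r > 0" "regular_nbrs (verts G) (nbrs G) r"
      "\<And>x. x \<in> verts G \<Longrightarrow> nbrs G x = verts G - {x}"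
  | (srg) r lam mu x y where "srg (verts G) (nbrs G) r lam mu" "mu > 0" "lam + 2 \<le> r"
      "x \<in> verts G" "y \<in> verts G" "x \<noteq> y" "y \<notin> nbrs G x"
proof -
  let ?V = "verts G" and ?N = "nbrs G"
  have dr: "distance_regular G" and d2: "diameter G \<le> 2"
    using assms by (auto simp: strongly_regular_def)
  then have simple: "simple_graph G" and conn: "connected_graph G"
    by (auto simp: distance_regular_def)
  obtain r b c where "regular_graph G r" and r: "r > 0"
    and bpos: "\<forall>i<diameter G. b i > (0::nat)"
    and cpos: "\<forall>i\<in>{1..diameter G}. c i > (0::nat)"
    and C: "\<forall>u\<in>?V. \<forall>v\<in>?V. \<forall>i\<in>{1..diameter G}. gdist G u v = i \<longrightarrow>
      card {w \<in> ?N u. gdist G w v = i - 1} = c i"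
    and B: "\<forall>u\<in>?V. \<forall>v\<in>?V. \<forall>i<diameter G. gdist G u v = i \<longrightarrow>
      card {w \<in> ?N u. gdist G w v = i + 1} = b i"
    using dr unfolding distance_regular_def Let_def by blast
  then have reg: "card (?N x) = r" if "x \<in> ?V" for x
    using that by (simp add: regular_graph_def)
  have fin: "finite ?V" and ne: "?V \<noteq> {}" using simple by (auto simp: simple_graph_def)
  interpret regular_nbrs ?V ?N r
  proof
    show "?N x \<subseteq> ?V" for x using nbrs_simple_graph[OF simple] by blast
    show "x \<notin> ?N x" for x using nbrs_simple_graph(3)[OF simple] by blast
  qed (rule fin nbrs_commute reg; assumption?)+
  have g0: "gdist G u v = 0 \<longleftrightarrow> u = v" if "u \<in> ?V" "v \<in> ?V" for u v
    using gdist_eq_0_iff[OF conn that] .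
  have g1: "gdist G u v = 1 \<longleftrightarrow> u \<in> ?N v" if "u \<in> ?V" "v \<in> ?V" for u v
    using gdist_eq_1_iff[OF simple conn that] .
  have le: "gdist G u v \<le> diameter G" if "u \<in> ?V" "v \<in> ?V" for u v
    using gdist_le_diameter[OF fin that] .
  obtain p where p: "p \<in> ?V" using ne by blast
  then have "?N p \<noteq> {}" using reg[of p] r by auto
  then obtain q where q: "q \<in> ?N p" by blast
  have "q \<in> ?V" "p \<noteq> q" using q nbrs_simple_graph[OF simple q] by auto
  then have "diameter G \<noteq> 0" using le[of p q] g0[of p q] p by simp
  then consider "diameter G = 1" | "diameter G = 2" using d2 by linarith
  then show ?thesis
  proof cases
    case 1
    have "?N x = ?V - {x}" if x: "x \<in> ?V" for x
    proof
      show "?N x \<subseteq> ?V - {x}" using nbrs_simple_graph[OF simple] by blast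
      show "?V - {x} \<subseteq> ?N x"
      proof
        fix y assume y: "y \<in> ?V - {x}"
        then have "gdist G y x \<le> 1" "gdist G y x \<noteq> 0" using le[of y x] g0[of y x] x 1 by auto
        then have "gdist G y x = 1" by simp
        then show "y \<in> ?N x" using g1 x y by blast
      qed
    qed
    then show ?thesis using complete r regular_nbrs_axioms by blast
  next
    case 2
    have g2: "gdist G u v = 2 \<longleftrightarrow> u \<noteq> v \<and> u \<notin> ?N v" if "u \<in> ?V" "v \<in> ?V" for u v
      using g0[OF that] g1[OF that] le[OF that] 2 by auto
    \<comment> \<open>Neighbours of \<open>x\<close> are split by their distance 1, 0 or 2 from
      \<open>y\<close>.\<close>
    have adj: "r = card (?N x \<inter> ?N y) + 1 + b 1" if x: "x \<in> ?V" and y: "y \<in> ?N x" for x y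
    proof -
      have yV: "y \<in> ?V" and xy: "x \<in> ?N y" "y \<noteq> x"
        using nbrs_simple_graph[OF simple y] y nbrs_commute[of y G x] by simp_all
      let ?D = "{w \<in> ?N x. gdist G w y = 2}"
      have sub: "w \<in> ?V" if "w \<in> ?N x" for w using that nbrs_simple_graph[OF simple] by blast
      have split: "?N x = (?N x \<inter> ?N y) \<union> ({y} \<union> ?D)"
        using y sub g2[OF _ yV] by auto
      have disj: "(?N x \<inter> ?N y) \<inter> ({y} \<union> ?D) = {}" "{y} \<inter> ?D = {}"
        using sub g2[OF _ yV] yV nbrs_irrefl by auto
      have "card (?N x) = card (?N x \<inter> ?N y) + card ({y} \<union> ?D)"
        by (subst split, rule card_Un_disjoint) (use disj finite_nbrs[OF x] in auto)
      also have "card ({y} \<union> ?D) = 1 + card ?D"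
        by (subst card_Un_disjoint) (use disj finite_nbrs[OF x] in auto)
      also have "card ?D = b 1"
        using B[rule_format, OF x yV, of 1] 2 xy(1) g1[OF x yV] by (simp add: numeral_2_eq_2)
      finally show ?thesis using reg[OF x] by simp
    qed
    have nonadj: "card (?N x \<inter> ?N y) = c 2" if "x \<in> ?V" "y \<in> ?V" "x \<noteq> y" "y \<notin> ?N x" for x y
    proof -
      have "gdist G x y = 2" using g2[OF that(1,2)] that nbrs_commute[of x G y] by simp
      then have "card {w \<in> ?N x. gdist G w y = 1} = c 2" using C[rule_format, OF that(1,2), of 2] 2 by simp
      moreover have "{w \<in> ?N x. gdist G w y = 1} = ?N x \<inter> ?N y"
        using g1[OF _ that(2)] nbrs_simple_graph[OF simple] by blast
      ultimately show ?thesis by simp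
    qed
    have b1: "b 1 > 0" using bpos 2 by simp
    \<comment> \<open>The natural-number subtraction is exact by \<open>adj\<close>.\<close>
    have "srg ?V ?N r (r - 1 - b 1) (c 2)"
    proof unfold_locales
      fix x y assume "x \<in> ?V" "y \<in> ?N x"
      then show "card (?N x \<inter> ?N y) = r - 1 - b 1" using adj by fastforce
    qed (rule nonadj)
    moreover have "c 2 > 0" using cpos 2 by simp
    moreover have "r - 1 - b 1 + 2 \<le> r" using adj[OF p q] b1 by simp
    moreover obtain x y where xy: "x \<in> ?V" "y \<in> ?V" "gdist G x y = 2"
      using diameter_attained[OF fin ne] 2 by metis
    moreover have "x \<noteq> y" "y \<notin> ?N x" using g2[OF xy(1,2)] xy(3) nbrs_commute[of x G y] by simp_all
    ultimately show ?thesis using srg by blast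
  qed
qed

section \<open>From labellings of the line graph to vertex weights\<close>

lemma nbrs_line_graph:
  assumes "e \<in> edges G"
  shows "nbrs (line_graph G) e = {e' \<in> edges G. e' \<noteq> e \<and> e' \<inter> e \<noteq> {}}"
  using assms by (auto simp: nbrs_def line_graph_def doubleton_eq_iff)

text \<open>Only \<open>{u, v}\<close> itself contains both ends, so the other edges at
  \<open>u\<close> and at \<open>v\<close> are disjoint families; each full sum counts
  \<open>{u, v}\<close> once too often.\<close>

lemma sum_nbrs_line_graph:
  fixes f :: "'a set \<Rightarrow> int"
  assumes simple: "simple_graph G" and uv: "v \<in> nbrs G u"
  shows "(\<Sum>e\<in>nbrs (line_graph G) {u, v}. f e) =
    (\<Sum>y\<in>nbrs G u. f {u, y}) + (\<Sum>y\<in>nbrs G v. f {v, y}) - 2 * f {u, v}"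
proof -
  let ?A = "(\<lambda>y. {u, y}) ` (nbrs G u - {v})" and ?B = "(\<lambda>y. {v, y}) ` (nbrs G v - {u})"
  have e: "{u, v} \<in> edges G" using uv by (simp add: edge_iff_nbr)
  have ne: "u \<noteq> v" using nbrs_simple_graph[OF simple uv] by simp
  have fin: "finite (nbrs G w)" for w
    using nbrs_simple_graph[OF simple] simple
    by (meson finite_subset simple_graph_def subsetI)
  have "nbrs (line_graph G) {u, v} = ?A \<union> ?B"
  proof
    show "nbrs (line_graph G) {u, v} \<subseteq> ?A \<union> ?B"
    proof
      fix e' assume "e' \<in> nbrs (line_graph G) {u, v}"
      then have e': "e' \<in> edges G" "e' \<noteq> {u, v}" "u \<in> e' \<or> v \<in> e'"
        unfolding nbrs_line_graph[OF e] by auto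
      obtain p q where pq: "e' = {p, q}" "q \<in> nbrs G p" "p \<in> nbrs G q"
        using edgeE[OF simple e'(1)] nbrs_commute by metis
      then show "e' \<in> ?A \<union> ?B" using e'(2,3) by (auto simp: insert_commute)
    qed
    show "?A \<union> ?B \<subseteq> nbrs (line_graph G) {u, v}"
      unfolding nbrs_line_graph[OF e] by (auto simp: edge_iff_nbr doubleton_eq_iff)
  qed
  moreover have "?A \<inter> ?B = {}" using ne by (auto simp: doubleton_eq_iff)
  ultimately have "(\<Sum>e\<in>nbrs (line_graph G) {u, v}. f e) = sum f ?A + sum f ?B"
    using fin by (simp add: sum.union_disjoint)
  also have "sum f ?A = (\<Sum>y\<in>nbrs G u - {v}. f {u, y})"
    by (subst sum.reindex) (auto simp: inj_on_def doubleton_eq_iff)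
  also have "\<dots> = (\<Sum>y\<in>nbrs G u. f {u, y}) - f {u, v}"
    using fin uv by (simp add: sum_diff1)
  also have "sum f ?B = (\<Sum>y\<in>nbrs G v - {u}. f {v, y})"
    by (subst sum.reindex) (auto simp: inj_on_def doubleton_eq_iff)
  also have "\<dots> = (\<Sum>y\<in>nbrs G v. f {v, y}) - f {u, v}"
    using fin uv nbrs_commute[of v G u] by (simp add: sum_diff1 insert_commute)
  finally show ?thesis by simp
qed

text \<open>If \<open>w x\<close> is the sum of the labels of the edges at \<open>x\<close>, then \<open>w u + w v = k + 2 * f {u, v}\<close>
  for every edge. Summing over the neighbours \<open>v\<close> of \<open>u\<close> gives an affine eigenvalue equation for
  \<open>w\<close>, made linear by the shift below (scaled by \<open>2r - 2\<close> to stay in the integers).\<close>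

lemma distance_magic_line_graph_weight:
  assumes simple: "simple_graph G" and "regular_nbrs (verts G) (nbrs G) r" and r: "r \<ge> 2"
    and magic: "distance_magic (line_graph G)"
  obtains h where "magic_weight (verts G) (nbrs G) r h"
proof -
  interpret regular_nbrs "verts G" "nbrs G" r by fact
  obtain f :: "'a set \<Rightarrow> nat" and k where inj: "inj_on f (edges G)"
    and f: "\<And>e. e \<in> edges G \<Longrightarrow> (\<Sum>y\<in>nbrs (line_graph G) e. f y) = k"
    using magic unfolding distance_magic_def by (auto simp: line_graph_def bij_betw_def)
  define w where "w u = (\<Sum>y\<in>nbrs G u. int (f {u, y}))" for u
  define h where "h u = (2 * int r - 2) * w u - int r * int k" for u
  have edge: "w u + w v = int k + 2 * int (f {u, v})" if "v \<in> nbrs G u" for u v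
  proof -
    have "(\<Sum>y\<in>nbrs (line_graph G) {u, v}. int (f y)) = int k"
      using f[of "{u, v}"] that by (simp add: edge_iff_nbr flip: of_nat_sum)
    then show ?thesis using sum_nbrs_line_graph[OF simple that, of "\<lambda>e. int (f e)"]
      by (simp add: w_def)
  qed
  have "magic_weight (verts G) (nbrs G) r h"
  proof unfold_locales
    show "r \<ge> 2" by fact
    show "verts G \<noteq> {}" using simple by (simp add: simple_graph_def)
    show "(\<Sum>y\<in>nbrs G x. h y) = (2 - int r) * h x" if x: "x \<in> verts G" for x
    proof -
      have "(\<Sum>y\<in>nbrs G x. w y) = (\<Sum>y\<in>nbrs G x. int k + 2 * int (f {x, y}) - w x)"
        by (rule sum.cong[OF refl]) (use edge in force)
      also have "\<dots> = int r * int k + 2 * w x - int r * w x"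
        using card_nbrs[OF x] by (simp add: sum.distrib sum_subtractf w_def sum_distrib_left)
      finally have *: "(\<Sum>y\<in>nbrs G x. w y) = int r * int k + 2 * w x - int r * w x" .
      have "(\<Sum>y\<in>nbrs G x. h y) = (2 * int r - 2) * (\<Sum>y\<in>nbrs G x. w y) - int r * (int r * int k)"
        unfolding h_def using card_nbrs[OF x] by (simp add: sum_subtractf sum_distrib_left)
      then show ?thesis unfolding * h_def by (simp add: algebra_simps)
    qed
    \<comment> \<open>By \<open>edge\<close>, the sum of \<open>w\<close> over the ends determines
      the label, so this reduces to injectivity of \<open>f\<close>.\<close>
    show "{x, y} = {u, v}"
      if "x \<in> verts G" "y \<in> nbrs G x" "u \<in> verts G" "v \<in> nbrs G u" "h x + h y = h u + h v"
      for x y u v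
    proof -
      have "(2 * int r - 2) * (w x + w y) = (2 * int r - 2) * (w u + w v)"
        using that(5) by (simp add: h_def algebra_simps)
      then have "w x + w y = w u + w v" using r by simp
      then have "f {x, y} = f {u, v}" using edge[OF that(2)] edge[OF that(4)] by simp
      then show ?thesis using inj that by (auto simp: inj_on_def edge_iff_nbr)
    qed
  qed
  then show ?thesis using that by blast
qed

section \<open>Recognising complete graphs and the 4-cycle, and labelling the latter\<close>

lemma complete_graphI:
  assumes simple: "simple_graph G" and "\<And>x. x \<in> verts G \<Longrightarrow> nbrs G x = verts G - {x}"
    and "card (verts G) = n"
  shows "complete_graph n G"
proof -
  have "e \<in> edges G" if "e \<subseteq> verts G" "card e = 2" for e
    using that assms(2) by (auto simp: card_2_iff edge_iff_nbr)
  then show ?thesis using assms by (auto simp: complete_graph_def simple_graph_def)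
qed

lemma lessThan_4: "{..<4} = {0, 1, 2, 3::nat}"
  by auto

lemma cycle_4_edges:
  "{{g i, g (Suc i mod 4)} |i. i < (4::nat)} = {{g 0, g 1}, {g 1, g 2}, {g 2, g 3}, {g 3, g 0}}"
proof -
  have "{{g i, g (Suc i mod 4)} |i. i < 4} = (\<lambda>i. {g i, g (Suc i mod 4)}) ` {..<4}" by auto
  moreover have "Suc 0 mod 4 = 1" "Suc 1 mod 4 = 2" "Suc 2 mod 4 = 3" "Suc 3 mod 4 = 0"
    by simp_all
  ultimately show ?thesis unfolding lessThan_4 by (simp only: image_insert image_empty)
qed

lemma cycle_graph_4_iff:
  "cycle_graph 4 G \<longleftrightarrow> (\<exists>a b c d. distinct [a, b, c, d] \<and> verts G = {a, b, c, d} \<and>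
    edges G = {{a, b}, {b, c}, {c, d}, {d, a}})"
proof
  assume "cycle_graph 4 G"
  then obtain g where "bij_betw g {..<4} (verts G)"
    and "edges G = {{g i, g (Suc i mod 4)} |i. i < 4}"
    by (auto simp: cycle_graph_def)
  then have "distinct [g 0, g 1, g 2, g 3]" "verts G = {g 0, g 1, g 2, g 3}"
    "edges G = {{g 0, g 1}, {g 1, g 2}, {g 2, g 3}, {g 3, g 0}}"
    unfolding cycle_4_edges lessThan_4 by (simp_all add: bij_betw_def)
  then show "\<exists>a b c d. distinct [a, b, c, d] \<and> verts G = {a, b, c, d} \<and>
    edges G = {{a, b}, {b, c}, {c, d}, {d, a}}" by blast
next
  assume "\<exists>a b c d. distinct [a, b, c, d] \<and> verts G = {a, b, c, d} \<and>
    edges G = {{a, b}, {b, c}, {c, d}, {d, a}}"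
  then obtain a b c d where *: "distinct [a, b, c, d]" "verts G = {a, b, c, d}"
    "edges G = {{a, b}, {b, c}, {c, d}, {d, a}}" by (elim exE conjE)
  define g where "g = (!) [a, b, c, d]"
  have g: "g 0 = a" "g 1 = b" "g 2 = c" "g 3 = d" by (simp_all add: g_def)
  have "bij_betw g {..<4} (verts G)"
    unfolding lessThan_4 bij_betw_def inj_on_def
    using * by (simp only: image_insert image_empty ball_simps g) auto
  moreover have "edges G = {{g i, g (Suc i mod 4)} |i. i < 4}"
    unfolding cycle_4_edges g by (rule *(3))
  ultimately show "cycle_graph 4 G" unfolding cycle_graph_def by auto
qed

text \<open>Degree 2 makes the two common neighbours \<open>a\<close>, \<open>b\<close> of
  \<open>x\<close>, \<open>y\<close> their only neighbours; \<open>card_vertices\<close> gives order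
  4, so nothing lies outside the cycle \<open>x\<close>, \<open>a\<close>, \<open>y\<close>,
  \<open>b\<close>.\<close>

lemma srg_2_0_2_cycle_graph:
  assumes simple: "simple_graph G" and "srg (verts G) (nbrs G) 2 0 2"
    and x: "x \<in> verts G" and y: "y \<in> verts G" "x \<noteq> y" "y \<notin> nbrs G x"
  shows "cycle_graph 4 G"
proof -
  interpret srg "verts G" "nbrs G" 2 0 2 by fact
  have "card (nbrs G x \<inter> nbrs G y) = 2" using card_nonadj x y by simp
  then obtain a b where ab: "nbrs G x \<inter> nbrs G y = {a, b}" "a \<noteq> b" by (auto simp: card_2_iff)
  have pair: "nbrs G u = {p, q}" if "u \<in> verts G" "{p, q} \<subseteq> nbrs G u" "p \<noteq> q" for u p q
    using card_subset_eq[OF finite_nbrs[OF that(1)] that(2)] that card_nbrs by simp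
  have nx: "nbrs G x = {a, b}" "nbrs G y = {a, b}"
    by (rule pair; use ab x y in blast)+
  then have V: "a \<in> verts G" "b \<in> verts G" using nbrs_subset[OF x] by auto
  have "x \<in> nbrs G a" "x \<in> nbrs G b" "y \<in> nbrs G a" "y \<in> nbrs G b"
    using nx nbrs_commute[of _ G x] nbrs_commute[of _ G y] by auto
  then have na: "nbrs G a = {x, y}" "nbrs G b = {x, y}"
    using pair[of a x y] pair[of b x y] V y by auto
  have d: "distinct [x, a, y, b]" using y ab nx nbrs_irrefl by auto
  have "card (verts G) = 4" using card_vertices[OF x] by simp
  then have v: "verts G = {x, a, y, b}"
    using card_subset_eq[of "verts G" "{x, a, y, b}"] finite_V x y V d by simp
  have E: "edges G = {{x, a}, {a, y}, {y, b}, {b, x}}"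
  proof
    show "edges G \<subseteq> {{x, a}, {a, y}, {y, b}, {b, x}}"
    proof
      fix e assume "e \<in> edges G"
      then obtain p q where "e = {p, q}" "p \<in> verts G" "q \<in> nbrs G p"
        using edgeE[OF simple] by metis
      then show "e \<in> {{x, a}, {a, y}, {y, b}, {b, x}}"
        using v nx na by (auto simp: insert_commute)
    qed
    show "{{x, a}, {a, y}, {y, b}, {b, x}} \<subseteq> edges G"
      using nx na by (simp add: edge_iff_nbr)
  qed
  show ?thesis unfolding cycle_graph_4_iff
    by (rule exI[of _ x], rule exI[of _ a], rule exI[of _ y], rule exI[of _ b]) (intro conjI d v E)
qed

lemma cycle_graph_4_distance_magic:
  assumes "cycle_graph 4 G"
  shows "distance_magic (line_graph G)"
proof -
  obtain a b c d where d: "distinct [a, b, c, d]"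
    and E: "edges G = {{a, b}, {b, c}, {c, d}, {d, a}}"
    using assms unfolding cycle_graph_4_iff by (elim exE conjE)
  \<comment> \<open>The two neighbours of an edge are opposite edges of the cycle, so labels 1, 2,
    4, 3 in cyclic order give the constant 5 = 1 + 4 = 2 + 3.\<close>
  let ?f = "\<lambda>e. if e = {a, b} then 1 else if e = {b, c} then 2 else if e = {c, d} then 4
    else (3::nat)"
  have ne: "{a, b} \<noteq> {b, c}" "{a, b} \<noteq> {c, d}" "{a, b} \<noteq> {d, a}" "{b, c} \<noteq> {c, d}"
    "{b, c} \<noteq> {d, a}" "{c, d} \<noteq> {d, a}" using d by (auto simp: doubleton_eq_iff)
  \<comment> \<open>Stated for any naming of the cycle, so that the four rotations are
    instances.\<close>
  have N: "nbrs (line_graph G) {p, q} = {{q, s}, {t, p}}"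
    if pq: "distinct [p, q, s, t]" and e: "edges G = {{p, q}, {q, s}, {s, t}, {t, p}}" for p q s t
  proof -
    have "{q, s} \<noteq> {p, q}" "{t, p} \<noteq> {p, q}" "{s, t} \<inter> {p, q} = {}"
      using pq by (auto simp: doubleton_eq_iff)
    moreover have "{p, q} \<in> edges G" unfolding e by simp
    ultimately show ?thesis unfolding nbrs_line_graph[OF \<open>{p, q} \<in> edges G\<close>] unfolding e by blast
  qed
  have N4: "nbrs (line_graph G) {a, b} = {{b, c}, {d, a}}"
    "nbrs (line_graph G) {b, c} = {{c, d}, {a, b}}"
    "nbrs (line_graph G) {c, d} = {{d, a}, {b, c}}"
    "nbrs (line_graph G) {d, a} = {{a, b}, {c, d}}"
    by (rule N; use d in \<open>auto simp: E\<close>)+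
  have "card (edges G) = 4" using ne by (simp add: E)
  moreover have "{1..4} = {1, 2, 3, 4::nat}" by auto
  moreover have "bij_betw ?f (edges G) {1, 2, 3, 4}"
    using ne ne[symmetric] unfolding bij_betw_def inj_on_def E by auto
  moreover have "\<forall>e\<in>edges G. (\<Sum>y\<in>nbrs (line_graph G) e. ?f y) = 5"
    unfolding E using ne ne[symmetric] by (simp add: N4)
  ultimately show ?thesis unfolding distance_magic_def by (auto simp: line_graph_def)
qed

theorem theorem8:
  fixes G :: "'a sgraph"
  assumes "strongly_regular G"
    and "\<not> complete_graph 2 G" and "\<not> complete_graph 4 G"
  shows "distance_magic (line_graph G) \<longleftrightarrow> cycle_graph 4 G"
proof
  assume magic: "distance_magic (line_graph G)"
  have simple: "simple_graph G"
    using assms(1) by (simp add: strongly_regular_def distance_regular_def)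
  from assms(1) show "cycle_graph 4 G"
  proof (cases rule: strongly_regular_cases)
    case (complete r)
    interpret regular_nbrs "verts G" "nbrs G" r by fact
    have "verts G \<noteq> {}" using simple by (simp add: simple_graph_def)
    then obtain x where x: "x \<in> verts G" by blast
    have "card (verts G) = r + 1"
      using card_nbrs[OF x] complete(3)[OF x] x finite_V \<open>r > 0\<close> by (simp add: card_Diff_singleton)
    \<comment> \<open>Degree 1 is the excluded complete graph of order 2; excluding it yields the
      \<open>r \<ge> 2\<close> required for the weight.\<close>
    then have "r \<noteq> 1"
      using complete_graphI[OF simple complete(3), of 2] assms(2) by auto
    then have "r \<ge> 2" using \<open>r > 0\<close> by simp
    then obtain h where "magic_weight (verts G) (nbrs G) r h"
      using distance_magic_line_graph_weight[OF simple complete(2) _ magic] by blast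
    then have "card (verts G) = 4"
      using magic_weight.complete_card complete(3) by blast
    then show ?thesis using complete_graphI[OF simple complete(3)] assms(3) by blast
  next
    case (srg r lam mu x y)
    have "regular_nbrs (verts G) (nbrs G) r" using srg(1) by (simp add: srg_def)
    moreover have "r \<ge> 2" using srg(3) by simp
    ultimately obtain h where "magic_weight (verts G) (nbrs G) r h"
      using distance_magic_line_graph_weight[OF simple _ _ magic] by blast
    then have "magic_srg (verts G) (nbrs G) r lam mu h"
      using srg(1) by (simp add: magic_srg_def)
    then have "r = 2 \<and> lam = 0 \<and> mu = 2"
      using srg by (intro magic_srg.parameters_eq)
    then show ?thesis using srg_2_0_2_cycle_graph[OF simple _ srg(4-7)] srg(1) by simp
  qed
next
  assume "cycle_graph 4 G"
  then show "distance_magic (line_graph G)" by (rule cycle_graph_4_distance_magic)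
qed

end
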